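(* Let $K\subset\mathbb{R}^n$ be a (nonempty) closed convex set and let $\mu\in\mathbb{R}^n$. Let $\sigma>0$, $\xi\sim\mathcal{N}(0,\sigma^2I_{n\times n})$, $y=\mu+\xi$ and $g=(1/\sigma)\xi$. Then almost surely $$\|\hat\mu^{LS}(K)-\Pi_K(\mu)\|\le\frac{\sigma}{\sqrt n}\left|\Pi_{\mathcal{T}_{K,\Pi_K(\mu)}}(g)\right|_2.$$ Furthermore, if $t_*>0$ is such that $$\mathbb{E}\sup_{v\in K:\ |v-\Pi_K(\mu)|_2\le t_*}\xi^T(v-\Pi_K(\mu))\le\frac{t_*^2}{2},$$ then for all $x>0$, with probability at least $1-e^{-x}$, $$|\hat\mu^{LS}(K)-\Pi_K(\mu)|_2\le t_*+\sigma\sqrt{2x}.$$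
   Context: $|\cdot|_2$ is the Euclidean norm on $\mathbb{R}^n$ and $\|v\|^2=\frac1n|v|_2^2$. $\Pi_K$ denotes the Euclidean projection onto a closed convex set $K$. The least squares estimator is $\hat\mu^{LS}(K)\in\operatorname{argmin}_{v\in K}\|y-v\|^2$, i.e. $\hat\mu^{LS}(K)=\Pi_K(y)$. Tangent cone of $K$ at $u$: $\mathcal{T}_{K,u}=\mathrm{closure}\{t(v-u): t\ge0,\ v\in K\}$. *)

theory Defs
  imports "HOL-Probability.Probability"
begin

text \<open>
  Vectors of dimension n are elements of \<^typ>\<open>real ^ 'n\<close> with \<open>n = CARD('n)\<close>. The norm of the library
  is the Euclidean norm, and the Euclidean projection of \<open>x\<close> onto \<open>K\<close> is \<open>closest_point K x\<close>.
\<close>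

definition scaled_norm :: "real ^ 'n \<Rightarrow> real" where
  "scaled_norm v = sqrt ((1 / real CARD('n)) * (norm v)\<^sup>2)"

definition lse :: "(real ^ 'n) set \<Rightarrow> real ^ 'n \<Rightarrow> real ^ 'n" where
  "lse K y = (ARG_MIN (\<lambda>v. (scaled_norm (y - v))\<^sup>2) v. v \<in> K)"

definition tangent_cone :: "(real ^ 'n) set \<Rightarrow> real ^ 'n \<Rightarrow> (real ^ 'n) set" where
  "tangent_cone K u = closure {t *\<^sub>R (v - u) | t v. t \<ge> 0 \<and> v \<in> K}"

text \<open>
  The Lebesgue density of the Gaussian law with mean \<open>m\<close> and covariance matrix \<open>\<sigma>\<^sup>2 I\<close>, for \<open>\<sigma> > 0\<close>.
\<close>

definition isotropic_normal_density :: "real ^ 'n \<Rightarrow> real \<Rightarrow> real ^ 'n \<Rightarrow> real" where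
  "isotropic_normal_density m \<sigma> x =
     1 / sqrt (2 * pi * \<sigma>\<^sup>2) ^ CARD('n) * exp (- (norm (x - m))\<^sup>2 / (2 * \<sigma>\<^sup>2))"

end

theory Submission
  imports Defs
begin

text \<open>
  Let \<open>u = closest_point K \<mu>\<close> and \<open>d = lse K y - u\<close>. The variational inequalities of the two projections
  give \<open>(norm d)\<^sup>2 \<le> \<xi> \<bullet> d\<close>. As \<open>d\<close> lies in the tangent cone, \<open>\<xi> \<bullet> d\<close> is at most the inner product of
  \<open>d\<close> with the projection of \<open>\<xi>\<close> onto that cone, whence the first bound.

  If \<open>norm d > t\<close>, shrinking \<open>d\<close> to length \<open>t\<close> yields \<open>t * norm d \<le> Z\<close> for the supremum \<open>Z\<close> in the
  hypothesis. As a function of \<open>\<xi>\<close>, \<open>Z\<close> is \<open>t\<close>-Lipschitz, so the second bound follows from Gaussian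
  concentration with the sharp constant. This is obtained from the one-dimensional Prekopa-Leindler
  inequality: with weights \<open>1 - c\<close> and \<open>c\<close>, followed by Jensen's inequality, it gives Talagrand's
  transport inequality in dual form with cost \<open>c * (x - y)\<^sup>2 / (2 * \<sigma>\<^sup>2)\<close>. The latter tensorizes, bounds
  the moment generating function of a Lipschitz function, and \<open>c\<close> tends to \<open>1\<close>.
\<close>

section \<open>The Prekopa-Leindler inequality on the line\<close>

lemma emeasure_lborel_affine_image:
  fixes t c :: real
  assumes "c \<noteq> 0" and "compact A"
  shows "emeasure lborel ((\<lambda>x. t + c * x) ` A) = ennreal \<bar>c\<bar> * emeasure lborel A"
proof -
  have "compact ((\<lambda>x. t + c * x) ` A)"
    by (intro compact_continuous_image continuous_intros assms)
  then have [measurable]: "(\<lambda>x. t + c * x) ` A \<in> sets borel" "A \<in> sets borel"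
    using assms by (auto intro: borel_compact)
  have "emeasure lborel ((\<lambda>x. t + c * x) ` A) = (\<integral>\<^sup>+x. indicator ((\<lambda>x. t + c * x) ` A) x \<partial>lborel)"
    by simp
  also have "\<dots> = \<bar>c\<bar> * (\<integral>\<^sup>+x. indicator ((\<lambda>x. t + c * x) ` A) (t + c * x) \<partial>lborel)"
    using \<open>c \<noteq> 0\<close> by (intro nn_integral_real_affine) auto
  also have "(\<lambda>x. indicator ((\<lambda>x. t + c * x) ` A) (t + c * x)) = (indicator A :: real \<Rightarrow> ennreal)"
    using \<open>c \<noteq> 0\<close> by (auto simp: indicator_def fun_eq_iff image_iff)
  finally show ?thesis by simp
qed

text \<open>With \<open>a\<close> the maximum of \<open>A\<close> and \<open>b\<close> the minimum
  of \<open>B\<close>, the translates \<open>A + b\<close> and \<open>B + a\<close> both lie in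
  \<open>S\<close> and lie on either side of \<open>a + b\<close>. They share only that point, a
  null set, so their lengths add up. Taking any Borel \<open>S\<close> that contains all sums makes
  the lemma fit superlevel sets directly.\<close>

lemma brunn_minkowski_real:
  fixes A B S :: "real set"
  assumes "compact A" "A \<noteq> {}" "compact B" "B \<noteq> {}" and S: "S \<in> sets borel"
    and sub: "\<And>x y. x \<in> A \<Longrightarrow> y \<in> B \<Longrightarrow> x + y \<in> S"
  shows "emeasure lborel A + emeasure lborel B \<le> emeasure lborel S"
proof -
  obtain a where a: "a \<in> A" "\<And>x. x \<in> A \<Longrightarrow> x \<le> a"
    using compact_attains_sup[OF assms(1,2)] by blast
  obtain b where b: "b \<in> B" "\<And>x. x \<in> B \<Longrightarrow> b \<le> x"
    using compact_attains_inf[OF assms(3,4)] by blast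
  let ?A = "(\<lambda>x. b + 1 * x) ` A" and ?B = "(\<lambda>x. a + 1 * x) ` B"
  have "compact ?A" "compact ?B"
    by (intro compact_continuous_image continuous_intros assms)+
  then have AB[measurable]: "?A \<in> sets borel" "?B \<in> sets borel" by (auto intro: borel_compact)
  have "emeasure lborel A + emeasure lborel B = emeasure lborel ?A + emeasure lborel ?B"
    using emeasure_lborel_affine_image[of 1 A b] emeasure_lborel_affine_image[of 1 B a] assms by simp
  also have "emeasure lborel ?A = emeasure lborel (?A - {a + b})"
    using AB by (intro emeasure_Diff_null_set[symmetric]) (auto simp: null_sets_def)
  also have "\<dots> + emeasure lborel ?B = emeasure lborel ((?A - {a + b}) \<union> ?B)"
    using a b by (intro plus_emeasure) (use AB in auto, fastforce)
  also have "\<dots> \<le> emeasure lborel S"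
    using sub[OF a(1)] sub[OF _ b(1)] S by (intro emeasure_mono) (auto simp: add.commute[of b])
  finally show ?thesis .
qed

text \<open>Layer-cake formula: \<open>ennreal (U x)\<close> is the length of
  \<open>{0<..U x}\<close>, and Tonelli swaps the two integrals. Negative values are harmless, since
  \<open>ennreal\<close> sends them to 0 and only positive levels are counted.\<close>

lemma nn_integral_eq_superlevel:
  fixes U :: "real \<Rightarrow> real"
  assumes [measurable]: "U \<in> borel_measurable borel"
  shows "(\<integral>\<^sup>+x. ennreal (U x) \<partial>lborel) =
    (\<integral>\<^sup>+\<tau>. emeasure lborel {x. \<tau> \<le> U x} * indicator {0<..} \<tau> \<partial>lborel)"
proof -
  have "(\<integral>\<^sup>+x. ennreal (U x) \<partial>lborel) =
      (\<integral>\<^sup>+x. (\<integral>\<^sup>+\<tau>. (if 0 < \<tau> \<and> \<tau> \<le> U x then 1 else 0) \<partial>lborel) \<partial>lborel)"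
  proof (rule nn_integral_cong)
    fix x
    have "(\<integral>\<^sup>+\<tau>. (if 0 < \<tau> \<and> \<tau> \<le> U x then 1 else 0) \<partial>lborel) =
        (\<integral>\<^sup>+\<tau>. indicator {0<..U x} \<tau> \<partial>lborel)"
      by (intro nn_integral_cong) (auto simp: indicator_def)
    also have "\<dots> = ennreal (U x)"
      by (cases "0 \<le> U x") (auto simp: ennreal_neg)
    finally show "ennreal (U x) = (\<integral>\<^sup>+\<tau>. (if 0 < \<tau> \<and> \<tau> \<le> U x then 1 else 0) \<partial>lborel)" by simp
  qed
  also have "\<dots> = (\<integral>\<^sup>+\<tau>. (\<integral>\<^sup>+x. (if 0 < \<tau> \<and> \<tau> \<le> U x then 1 else 0) \<partial>lborel) \<partial>lborel)"
    by (rule lborel_pair.Fubini'[symmetric]) measurable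
  also have "\<dots> = (\<integral>\<^sup>+\<tau>. emeasure lborel {x. \<tau> \<le> U x} * indicator {0<..} \<tau> \<partial>lborel)"
  proof (rule nn_integral_cong)
    fix \<tau> :: real
    have "(\<integral>\<^sup>+x. (if 0 < \<tau> \<and> \<tau> \<le> U x then 1 else 0) \<partial>lborel) =
      (\<integral>\<^sup>+x. indicator {x. \<tau> \<le> U x} x * indicator {0<..} \<tau> \<partial>lborel)"
      by (intro nn_integral_cong) (auto simp: indicator_def)
    also have "\<dots> = emeasure lborel {x. \<tau> \<le> U x} * indicator {0<..} \<tau>"
      by (subst nn_integral_multc) simp_all
    finally show "(\<integral>\<^sup>+x. (if 0 < \<tau> \<and> \<tau> \<le> U x then 1 else 0) \<partial>lborel) =
      emeasure lborel {x. \<tau> \<le> U x} * indicator {0<..} \<tau>" .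
  qed
  finally show ?thesis .
qed

lemma compact_superlevel:
  fixes U :: "real \<Rightarrow> real"
  assumes "continuous_on UNIV U" "(U \<longlongrightarrow> 0) at_infinity" "0 < \<tau>"
  shows "compact {x. \<tau> \<le> U x}"
proof -
  have "eventually (\<lambda>x. U x < \<tau>) at_infinity"
    using assms(2,3) by (rule order_tendstoD)
  then obtain b where b: "\<And>x. b \<le> norm x \<Longrightarrow> U x < \<tau>"
    by (auto simp: eventually_at_infinity)
  have "bounded {x. \<tau> \<le> U x}"
    using b by (intro boundedI[of _ b]) (force simp: not_le[symmetric])
  moreover have "closed {x. \<tau> \<le> U x}"
    using assms(1) by (intro closed_Collect_le) auto
  ultimately show ?thesis by (simp add: compact_eq_bounded_closed)
qed

lemma attains_max_of_decay:
  fixes U :: "real \<Rightarrow> real"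
  assumes "continuous_on UNIV U" "(U \<longlongrightarrow> 0) at_infinity" "0 < U 0"
  obtains z where "\<And>x. U x \<le> U z"
proof -
  have "compact {x. U 0 \<le> U x}" by (rule compact_superlevel) fact+
  moreover have "{x. U 0 \<le> U x} \<noteq> {}" by auto
  ultimately obtain z where "z \<in> {x. U 0 \<le> U x}" "\<forall>x\<in>{x. U 0 \<le> U x}. U x \<le> U z"
    using continuous_attains_sup[of "{x. U 0 \<le> U x}" U] assms(1) continuous_on_subset by blast
  then show ?thesis by (intro that[of z]) (metis linear mem_Collect_eq order.trans)
qed

text \<open>As both maxima equal 1, the superlevel sets of \<open>U\<close> and \<open>V\<close> are
  nonempty for exactly the same positive levels, those up to 1. There their scaled sum lies in the
  superlevel set of \<open>W\<close>, so Brunn-Minkowski compares lengths level by level, and the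
  layer-cake formula integrates this. Levels above 1 contribute nothing on the left.\<close>

lemma prekopa_leindler_real_normalized:
  fixes U V W :: "real \<Rightarrow> real"
  assumes U: "continuous_on UNIV U" "(U \<longlongrightarrow> 0) at_infinity" "\<And>x. U x \<le> 1" "U u = 1"
    and V: "continuous_on UNIV V" "(V \<longlongrightarrow> 0) at_infinity" "\<And>x. V x \<le> 1" "V v = 1"
    and W: "W \<in> borel_measurable borel"
    and sc: "0 < s" "0 < c"
    and UVW: "\<And>x y. min (U x) (V y) \<le> W (s * x + c * y)"
  shows "ennreal s * (\<integral>\<^sup>+x. U x \<partial>lborel) + ennreal c * (\<integral>\<^sup>+x. V x \<partial>lborel) \<le> (\<integral>\<^sup>+x. W x \<partial>lborel)"
proof -
  have [measurable]: "U \<in> borel_measurable borel" "V \<in> borel_measurable borel"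
    "W \<in> borel_measurable borel"
    using U(1) V(1) W by (auto intro: borel_measurable_continuous_onI)
  have [measurable]: "(\<lambda>\<tau>. emeasure lborel {x. \<tau> \<le> F x}) \<in> borel_measurable borel"
    if [measurable]: "F \<in> borel_measurable borel" for F :: "real \<Rightarrow> real"
  proof -
    \<comment> \<open>Written as the integral of a jointly measurable function, the length of a
      superlevel set is measurable in the level.\<close>
    have "(\<lambda>\<tau>. emeasure lborel {x. \<tau> \<le> F x}) = (\<lambda>\<tau>. \<integral>\<^sup>+x. (if \<tau> \<le> F x then 1 else 0) \<partial>lborel)"
    proof
      fix \<tau> :: real
      have "(\<integral>\<^sup>+x. (if \<tau> \<le> F x then 1 else 0) \<partial>lborel) = (\<integral>\<^sup>+x. indicator {x. \<tau> \<le> F x} x \<partial>lborel)"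
        by (intro nn_integral_cong) (auto simp: indicator_def)
      then show "emeasure lborel {x. \<tau> \<le> F x} = (\<integral>\<^sup>+x. (if \<tau> \<le> F x then 1 else 0) \<partial>lborel)"
        by simp
    qed
    then show ?thesis by simp
  qed
  have level: "ennreal s * emeasure lborel {x. \<tau> \<le> U x} + ennreal c * emeasure lborel {x. \<tau> \<le> V x}
      \<le> emeasure lborel {x. \<tau> \<le> W x}" if "0 < \<tau>" for \<tau>
  proof (cases "\<tau> \<le> 1")
    case True
    have cU: "compact {x. \<tau> \<le> U x}" and cV: "compact {x. \<tau> \<le> V x}"
      using U V that by (auto intro!: compact_superlevel)
    let ?A = "(\<lambda>x. 0 + s * x) ` {x. \<tau> \<le> U x}" and ?B = "(\<lambda>x. 0 + c * x) ` {x. \<tau> \<le> V x}"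
    have "emeasure lborel ?A + emeasure lborel ?B \<le> emeasure lborel {x. \<tau> \<le> W x}"
    proof (rule brunn_minkowski_real)
      show "compact ?A" "compact ?B"
        by (intro compact_continuous_image continuous_intros cU cV)+
      show "?A \<noteq> {}" "?B \<noteq> {}" using True U(4) V(4) by (metis (mono_tags) empty_iff image_is_empty mem_Collect_eq)+
      show "x + y \<in> {x. \<tau> \<le> W x}" if "x \<in> ?A" "y \<in> ?B" for x y
        using that UVW by (auto intro: order.trans[OF _ UVW])
    qed measurable
    then show ?thesis
      using emeasure_lborel_affine_image[OF _ cU, of s 0] emeasure_lborel_affine_image[OF _ cV, of c 0] sc
      by simp
  next
    case False
    then have "{x. \<tau> \<le> U x} = {}" "{x. \<tau> \<le> V x} = {}"
      using U(3) V(3) by (auto simp: not_le intro: le_less_trans)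
    then show ?thesis by simp
  qed
  have "ennreal s * (\<integral>\<^sup>+x. U x \<partial>lborel) + ennreal c * (\<integral>\<^sup>+x. V x \<partial>lborel) =
      (\<integral>\<^sup>+\<tau>. ennreal s * (emeasure lborel {x. \<tau> \<le> U x} * indicator {0<..} \<tau>) +
             ennreal c * (emeasure lborel {x. \<tau> \<le> V x} * indicator {0<..} \<tau>) \<partial>lborel)"
    by (simp add: nn_integral_eq_superlevel nn_integral_add nn_integral_cmult)
  also have "\<dots> \<le> (\<integral>\<^sup>+\<tau>. emeasure lborel {x. \<tau> \<le> W x} * indicator {0<..} \<tau> \<partial>lborel)"
    using level by (intro nn_integral_mono) (auto simp: indicator_def)
  also have "\<dots> = (\<integral>\<^sup>+x. W x \<partial>lborel)" by (simp add: nn_integral_eq_superlevel)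
  finally show ?thesis .
qed

text \<open>Divide \<open>U\<close> and \<open>V\<close> by their maxima and \<open>W\<close> by the
  weighted geometric mean \<open>m\<close> of these. A minimum is at most a weighted geometric mean,
  so the normalized case applies and bounds the weighted arithmetic mean of the two integrals.
  Young's inequality passes to the geometric mean, and the factor \<open>m\<close> cancels.\<close>

lemma prekopa_leindler_real:
  fixes U V W :: "real \<Rightarrow> real"
  assumes U: "continuous_on UNIV U" "(U \<longlongrightarrow> 0) at_infinity" "\<And>x. 0 < U x" "integrable lborel U"
    and V: "continuous_on UNIV V" "(V \<longlongrightarrow> 0) at_infinity" "\<And>x. 0 < V x" "integrable lborel V"
    and W: "integrable lborel W" "\<And>x. 0 \<le> W x"
    and sc: "0 < s" "0 < c" "s + c = 1"
    and UVW: "\<And>x y. U x powr s * V y powr c \<le> W (s * x + c * y)"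
  shows "(\<integral>x. U x \<partial>lborel) powr s * (\<integral>x. V x \<partial>lborel) powr c \<le> (\<integral>x. W x \<partial>lborel)"
proof -
  obtain u where u: "\<And>x. U x \<le> U u" using attains_max_of_decay[OF U(1,2,3)] by metis
  obtain v where v: "\<And>x. V x \<le> V v" using attains_max_of_decay[OF V(1,2,3)] by metis
  define a b where "a = U u" and "b = V v"
  have a: "0 < a" and b: "0 < b" by (simp_all add: a_def b_def U V)
  define m where "m = a powr s * b powr c"
  have m: "0 < m" using a b by (simp add: m_def)
  have minle: "min (U x / a) (V y / b) \<le> W (s * x + c * y) / m" for x y
  proof -
    let ?q = "min (U x / a) (V y / b)"
    have q: "0 < ?q" using a b U(3) V(3) by simp
    have "?q = ?q powr s * ?q powr c" using q sc by (simp add: powr_add[symmetric])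
    also have "\<dots> \<le> (U x / a) powr s * (V y / b) powr c"
      using q sc by (intro mult_mono powr_mono2) auto
    also have "\<dots> = (U x powr s * V y powr c) / m"
      using a b U(3) V(3) by (simp add: powr_divide less_imp_le m_def)
    also have "\<dots> \<le> W (s * x + c * y) / m"
      using UVW m by (intro divide_right_mono) auto
    finally show ?thesis .
  qed
  have "ennreal s * (\<integral>\<^sup>+x. U x / a \<partial>lborel) + ennreal c * (\<integral>\<^sup>+x. V x / b \<partial>lborel)
      \<le> (\<integral>\<^sup>+x. W x / m \<partial>lborel)"
  proof (rule prekopa_leindler_real_normalized[where u=u and v=v])
    show "continuous_on UNIV (\<lambda>x. U x / a)" "continuous_on UNIV (\<lambda>x. V x / b)"
      using a b by (auto intro!: continuous_intros U V)
    show "((\<lambda>x. U x / a) \<longlongrightarrow> 0) at_infinity" "((\<lambda>x. V x / b) \<longlongrightarrow> 0) at_infinity"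
      using tendsto_divide[OF U(2) tendsto_const, of a] tendsto_divide[OF V(2) tendsto_const, of b] a b
      by auto
    show "(\<lambda>x. W x / m) \<in> borel_measurable borel" using borel_measurable_integrable[OF W(1)] by simp
  qed (use a b u v sc minle in \<open>auto simp: a_def b_def\<close>)
  also have "(\<integral>\<^sup>+x. U x / a \<partial>lborel) = ennreal ((\<integral>x. U x \<partial>lborel) / a)"
    using U a by (subst nn_integral_eq_integral) (auto simp: less_imp_le)
  also have "(\<integral>\<^sup>+x. V x / b \<partial>lborel) = ennreal ((\<integral>x. V x \<partial>lborel) / b)"
    using V b by (subst nn_integral_eq_integral) (auto simp: less_imp_le)
  also have "(\<integral>\<^sup>+x. W x / m \<partial>lborel) = ennreal ((\<integral>x. W x \<partial>lborel) / m)"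
    using W m by (subst nn_integral_eq_integral) (auto simp: less_imp_le)
  finally have *: "s * ((\<integral>x. U x \<partial>lborel) / a) + c * ((\<integral>x. V x \<partial>lborel) / b) \<le> (\<integral>x. W x \<partial>lborel) / m"
    using sc a b m U(3) V(3) W(2)
    by (simp add: ennreal_mult'[symmetric] ennreal_plus[symmetric] less_imp_le Bochner_Integration.integral_nonneg
        del: ennreal_plus)
  have "((\<integral>x. U x \<partial>lborel) / a) powr s * ((\<integral>x. V x \<partial>lborel) / b) powr c
      \<le> s * ((\<integral>x. U x \<partial>lborel) / a) + c * ((\<integral>x. V x \<partial>lborel) / b)"
  \<comment> \<open>Young's inequality is applied to positive numbers; if an integral vanishes, so
    does the left side, because \<open>0 powr s = 0\<close>.\<close>
  proof (cases "(\<integral>x. U x \<partial>lborel) = 0 \<or> (\<integral>x. V x \<partial>lborel) = 0")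
    case True
    then show ?thesis
      using sc a b U(3) V(3) by (auto simp: less_imp_le Bochner_Integration.integral_nonneg)
  next
    case False
    then have "0 < (\<integral>x. U x \<partial>lborel)" "0 < (\<integral>x. V x \<partial>lborel)"
      using U(3) V(3) by (simp_all add: less_le Bochner_Integration.integral_nonneg)
    then show ?thesis using sc a b by (intro Youngs_inequality_0) auto
  qed
  with * have "((\<integral>x. U x \<partial>lborel) / a) powr s * ((\<integral>x. V x \<partial>lborel) / b) powr c \<le> (\<integral>x. W x \<partial>lborel) / m"
    by linarith
  then show ?thesis
    using a b U(3) V(3) m
    by (simp add: powr_divide less_imp_le Bochner_Integration.integral_nonneg m_def[symmetric] divide_le_cancel)
qed

section \<open>Talagrand's transport inequality\<close>

lemma continuous_on_of_lipschitz_real: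
  fixes q :: "'a::metric_space \<Rightarrow> real"
  assumes "\<And>x y. \<bar>q x - q y\<bar> \<le> L * dist x y"
  shows "continuous_on UNIV q"
proof (rule lipschitz_on_continuous_on)
  \<comment> \<open>\<open>lipschitz_on\<close> demands a nonnegative constant, while the sign of
    \<open>L\<close> is not assumed.\<close>
  show "(max L 0)-lipschitz_on UNIV q"
    using order.trans[OF assms mult_right_mono[of L "max L 0"]] by (auto simp: lipschitz_on_def dist_real_def)
qed

lemma integrable_of_lipschitz_real:
  fixes q :: "real \<Rightarrow> real"
  assumes N: "prob_space N" "sets N = sets borel" "integrable N (\<lambda>x. x)"
    and L: "\<And>x y. \<bar>q x - q y\<bar> \<le> L * \<bar>x - y\<bar>"
  shows "integrable N q"
proof (rule Bochner_Integration.integrable_bound)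
  interpret prob_space N by fact
  show "integrable N (\<lambda>x. \<bar>q 0\<bar> + L * \<bar>x\<bar>)" using N by simp
  have "continuous_on UNIV q"
    by (rule continuous_on_of_lipschitz_real[of _ L]) (use L in \<open>auto simp: dist_real_def\<close>)
  then show "q \<in> borel_measurable N"
    using N(2) by (simp add: borel_measurable_continuous_onI cong: measurable_cong_sets)
  show "AE x in N. norm (q x) \<le> norm (\<bar>q 0\<bar> + L * \<bar>x\<bar>)"
    using L[of _ 0] by (intro AE_I2) (smt (verit) diff_zero real_norm_def)
qed

text \<open>Half of the Gaussian exponent absorbs the linear growth of \<open>q\<close>: completing
  the square gives \<open>L * \<bar>x\<bar> \<le> x\<^sup>2 / (4 * \<sigma>\<^sup>2) + L\<^sup>2 *
  \<sigma>\<^sup>2\<close>. Hence a multiple of the centred Gaussian density with twice the variance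
  dominates, and it yields both integrability and decay.\<close>

lemma
  fixes q :: "real \<Rightarrow> real"
  assumes \<sigma>: "0 < \<sigma>" and L: "\<And>x y. \<bar>q x - q y\<bar> \<le> L * \<bar>x - y\<bar>"
  shows integrable_exp_lipschitz_normal: "integrable lborel (\<lambda>x. normal_density 0 \<sigma> x * exp (q x))"
    and tendsto_exp_lipschitz_normal: "((\<lambda>x. normal_density 0 \<sigma> x * exp (q x)) \<longlongrightarrow> 0) at_infinity"
proof -
  define \<tau> where "\<tau> = sqrt 2 * \<sigma>"
  \<comment> \<open>The factor \<open>sqrt 2\<close> is the quotient of the normalizing constants of
    the two Gaussian densities.\<close>
  define C where "C = exp (q 0 + L\<^sup>2 * \<sigma>\<^sup>2) * sqrt 2"
  have \<tau>: "0 < \<tau>" "\<tau>\<^sup>2 = 2 * \<sigma>\<^sup>2" using \<sigma> by (auto simp: \<tau>_def power_mult_distrib)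
  have bound: "normal_density 0 \<sigma> x * exp (q x) \<le> C * normal_density 0 \<tau> x" for x
  proof -
    have "0 \<le> (\<bar>x\<bar> / (2 * \<sigma>) - L * \<sigma>)\<^sup>2" by simp
    also have "\<dots> = x\<^sup>2 / (4 * \<sigma>\<^sup>2) - L * \<bar>x\<bar> + L\<^sup>2 * \<sigma>\<^sup>2"
      using \<sigma> by (simp add: power2_diff power_divide power_mult_distrib)
    finally have "q x \<le> q 0 + L\<^sup>2 * \<sigma>\<^sup>2 + x\<^sup>2 / (4 * \<sigma>\<^sup>2)"
      using L[of x 0] by auto
    moreover have "x\<^sup>2 / (2 * \<sigma>\<^sup>2) = 2 * (x\<^sup>2 / (4 * \<sigma>\<^sup>2))" by simp
    ultimately have "q x - x\<^sup>2 / (2 * \<sigma>\<^sup>2) \<le> q 0 + L\<^sup>2 * \<sigma>\<^sup>2 - x\<^sup>2 / (4 * \<sigma>\<^sup>2)"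
      by linarith
    then have "exp (q x - x\<^sup>2 / (2 * \<sigma>\<^sup>2)) \<le> exp (q 0 + L\<^sup>2 * \<sigma>\<^sup>2 - x\<^sup>2 / (4 * \<sigma>\<^sup>2))" by simp
    then have "exp (q x) * exp (- x\<^sup>2 / (2 * \<sigma>\<^sup>2)) \<le> exp (q 0 + L\<^sup>2 * \<sigma>\<^sup>2) * exp (- x\<^sup>2 / (4 * \<sigma>\<^sup>2))"
      by (simp add: exp_add[symmetric])
    moreover have "sqrt (2 * pi * \<tau>\<^sup>2) = sqrt 2 * sqrt (2 * pi * \<sigma>\<^sup>2)"
      unfolding \<tau>(2) by (simp add: real_sqrt_mult)
    ultimately show ?thesis
      using \<sigma> \<tau> by (simp add: normal_density_def C_def divide_simps mult.commute)
  qed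
  have cont: "continuous_on UNIV q"
    by (rule continuous_on_of_lipschitz_real[of _ L]) (use L in \<open>auto simp: dist_real_def\<close>)
  then have [measurable]: "q \<in> borel_measurable borel" by (rule borel_measurable_continuous_onI)
  show "integrable lborel (\<lambda>x. normal_density 0 \<sigma> x * exp (q x))"
    by (rule Bochner_Integration.integrable_bound[where f = "\<lambda>x. C * normal_density 0 \<tau> x"])
      (use \<tau> bound in \<open>auto simp: C_def abs_mult\<close>)
  have "filterlim (\<lambda>x::real. (norm x)\<^sup>2 * (1 / (2 * \<tau>\<^sup>2))) at_top at_infinity"
    using \<tau>(1) by (intro filterlim_at_top_mult_tendsto_pos[OF tendsto_const] filterlim_pow_at_top
        filterlim_norm_at_top) auto
  then have "((\<lambda>x::real. exp (- ((norm x)\<^sup>2 * (1 / (2 * \<tau>\<^sup>2))))) \<longlongrightarrow> 0) at_infinity"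
    by (intro filterlim_compose[OF exp_at_bot]) (simp add: filterlim_uminus_at_top)
  then have "((\<lambda>x::real. C * (1 / sqrt (2 * pi * \<tau>\<^sup>2) * exp (- ((norm x)\<^sup>2 * (1 / (2 * \<tau>\<^sup>2)))))) \<longlongrightarrow> C * (1 / sqrt (2 * pi * \<tau>\<^sup>2) * 0)) at_infinity"
    by (intro tendsto_intros)
  then have "((\<lambda>x::real. C * normal_density 0 \<tau> x) \<longlongrightarrow> 0) at_infinity"
    by (simp add: normal_density_def)
  then show "((\<lambda>x. normal_density 0 \<sigma> x * exp (q x)) \<longlongrightarrow> 0) at_infinity"
    by (rule tendsto_sandwich[OF _ _ tendsto_const, rotated -1]) (use bound in auto)
qed

text \<open>
  The dual form of Talagrand's transport inequality with cost \<open>\<kappa> * (x - y)\<^sup>2\<close>; among all \<open>h\<close>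
  admitted for a given \<open>f\<close>, the largest is the infimum convolution of \<open>f\<close> with the cost.
\<close>

definition transport_inequality :: "real measure \<Rightarrow> real \<Rightarrow> bool" where
  "transport_inequality N \<kappa> \<longleftrightarrow> (\<forall>f h L.
     (\<forall>x y. \<bar>f x - f y\<bar> \<le> L * \<bar>x - y\<bar>) \<longrightarrow> (\<forall>x y. \<bar>h x - h y\<bar> \<le> L * \<bar>x - y\<bar>) \<longrightarrow>
     (\<forall>x y. h x \<le> f y + \<kappa> * (x - y)\<^sup>2) \<longrightarrow>
     (\<integral>\<^sup>+x. ennreal (exp (h x)) \<partial>N) \<le> ennreal (exp (\<integral>x. f x \<partial>N)))"

lemma integrable_ident_normal:
  assumes "0 < \<sigma>"
  shows "integrable (density lborel (normal_density 0 \<sigma>)) (\<lambda>x. x)"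
  using integrable_normal_moment_nz_1[OF assms, of 0]
  by (subst integrable_density) auto

text \<open>Prekopa-Leindler is applied to the Gaussian density times \<open>exp h\<close>, the
  density times \<open>exp f'\<close>, and the density itself as the upper function, whose integral
  is 1. The cost is exactly what the strong concavity of the Gaussian log-density can pay for.
  Jensen then bounds the integral of \<open>exp f'\<close> from below through the mean of
  \<open>f\<close>.\<close>

lemma transport_inequality_normal:
  assumes \<sigma>: "0 < \<sigma>" and c: "0 < c" "c < 1"
  shows "transport_inequality (density lborel (normal_density 0 \<sigma>)) (c / (2 * \<sigma>\<^sup>2))"
  unfolding transport_inequality_def
proof (intro allI impI)
  fix f h :: "real \<Rightarrow> real" and L :: real
  assume "\<forall>x y. \<bar>f x - f y\<bar> \<le> L * \<bar>x - y\<bar>" "\<forall>x y. \<bar>h x - h y\<bar> \<le> L * \<bar>x - y\<bar>"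
    and hf: "\<forall>x y. h x \<le> f y + c / (2 * \<sigma>\<^sup>2) * (x - y)\<^sup>2"
  then have fL: "\<bar>f x - f y\<bar> \<le> L * \<bar>x - y\<bar>" and hL: "\<bar>h x - h y\<bar> \<le> L * \<bar>x - y\<bar>" for x y by auto
  let ?N = "density lborel (normal_density 0 \<sigma>)"
  interpret N: prob_space ?N by (rule prob_space_normal_density[OF \<sigma>])
  define s where "s = 1 - c"
  have s: "0 < s" "s + c = 1" using c by (auto simp: s_def)
  \<comment> \<open>The factor is chosen such that
    \<open>s * h x + c * f' y = s * (h x - f y)\<close>, which the hypothesis on \<open>h\<close>
    and \<open>f\<close> controls.\<close>
  define f' where "f' x = - (s / c) * f x" for x
  have f'L: "\<bar>f' x - f' y\<bar> \<le> (s / c * L) * \<bar>x - y\<bar>" for x y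
  proof -
    have "f' x - f' y = - (s / c) * (f x - f y)" by (simp only: f'_def right_diff_distrib)
    then have "\<bar>f' x - f' y\<bar> = (s / c) * \<bar>f x - f y\<bar>"
      using s c by (simp add: abs_mult)
    also have "\<dots> \<le> (s / c) * (L * \<bar>x - y\<bar>)" using s c by (intro mult_left_mono fL) auto
    finally show ?thesis by (simp add: mult.assoc)
  qed
  have cont: "continuous_on UNIV f" "continuous_on UNIV h" "continuous_on UNIV f'"
    using continuous_on_of_lipschitz_real[of f L] continuous_on_of_lipschitz_real[of h L]
      continuous_on_of_lipschitz_real[of f' "s / c * L"] fL hL f'L by (auto simp: dist_real_def)
  then have [measurable]: "f \<in> borel_measurable borel" "h \<in> borel_measurable borel" "f' \<in> borel_measurable borel"
    by (auto intro: borel_measurable_continuous_onI)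
  define U where "U x = normal_density 0 \<sigma> x * exp (h x)" for x
  define V where "V x = normal_density 0 \<sigma> x * exp (f' x)" for x
  have nd_cont: "continuous_on UNIV (normal_density 0 \<sigma>)"
    unfolding normal_density_def by (intro continuous_intros) (use \<sigma> in auto)
  have UVW: "U x powr s * V y powr c \<le> normal_density 0 \<sigma> (s * x + c * y)" for x y
  proof -
    have ln_nd: "ln (normal_density 0 \<sigma> z) = - ln (sqrt (2 * pi * \<sigma>\<^sup>2)) - z\<^sup>2 / (2 * \<sigma>\<^sup>2)" for z
      using \<sigma> by (simp add: normal_density_def ln_mult ln_div)
    have U_pos: "0 < U x" and V_pos: "0 < V y" using normal_density_pos[OF \<sigma>, of 0] by (auto simp: U_def V_def)
    have lnU: "ln (U x) = ln (normal_density 0 \<sigma> x) + h x" and lnV: "ln (V y) = ln (normal_density 0 \<sigma> y) + f' y"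
      using normal_density_pos[OF \<sigma>, of 0] by (auto simp: U_def V_def ln_mult less_imp_neq[symmetric])
    have "s * h x + c * f' y = s * (h x - f y)" using c by (simp add: f'_def algebra_simps)
    also have "\<dots> \<le> s * (c / (2 * \<sigma>\<^sup>2) * (x - y)\<^sup>2)"
      using hf s by (intro mult_left_mono) (auto simp: algebra_simps)
    \<comment> \<open>With \<open>s = 1 - c\<close>, the convexity defect of the square at the
      weights \<open>s\<close> and \<open>c\<close> is \<open>s * c * (x - y)\<^sup>2\<close>. This
      is the origin of the constant in the cost.\<close>
    also have "\<dots> = (s * x\<^sup>2 + c * y\<^sup>2 - (s * x + c * y)\<^sup>2) / (2 * \<sigma>\<^sup>2)"
      unfolding s_def by (simp add: power2_eq_square algebra_simps diff_divide_distrib add_divide_distrib)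
    finally have "s * h x + c * f' y - s * x\<^sup>2 / (2 * \<sigma>\<^sup>2) - c * y\<^sup>2 / (2 * \<sigma>\<^sup>2) \<le> - (s * x + c * y)\<^sup>2 / (2 * \<sigma>\<^sup>2)"
      by (simp add: diff_divide_distrib add_divide_distrib)
    \<comment> \<open>Used for the logarithm of the normalizing constant, which both densities on
      the left carry.\<close>
    moreover have "s * K + c * K = K" for K using s(2) by (metis distrib_right mult_1)
    ultimately have "s * ln (U x) + c * ln (V y) \<le> ln (normal_density 0 \<sigma> (s * x + c * y))"
      unfolding lnU lnV ln_nd
      by (simp add: algebra_simps) (smt (verit) mult.commute)
    then have "exp (s * ln (U x) + c * ln (V y)) \<le> exp (ln (normal_density 0 \<sigma> (s * x + c * y)))"
      by simp
    then show ?thesis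
      using U_pos V_pos normal_density_pos[OF \<sigma>, of 0] by (simp add: powr_def exp_add)
  qed
  have PL: "(\<integral>x. U x \<partial>lborel) powr s * (\<integral>x. V x \<partial>lborel) powr c \<le> (\<integral>x. normal_density 0 \<sigma> x \<partial>lborel)"
  proof (rule prekopa_leindler_real)
    show "continuous_on UNIV U" "continuous_on UNIV V"
      unfolding U_def V_def by (intro continuous_intros cont nd_cont)+
    show "(U \<longlongrightarrow> 0) at_infinity" "(V \<longlongrightarrow> 0) at_infinity"
      unfolding U_def V_def using tendsto_exp_lipschitz_normal[OF \<sigma>] hL f'L by blast+
    show "integrable lborel U" "integrable lborel V"
      unfolding U_def V_def using integrable_exp_lipschitz_normal[OF \<sigma>] hL f'L by blast+
  qed (use \<sigma> s c UVW normal_density_pos[OF \<sigma>, of 0] in \<open>auto simp: U_def V_def\<close>)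
  have intf: "integrable ?N f"
    by (rule integrable_of_lipschitz_real[OF N.prob_space_axioms _ integrable_ident_normal[OF \<sigma>] fL]) simp
  have "exp (\<integral>x. f' x \<partial>?N) \<le> (\<integral>x. exp (f' x) \<partial>?N)"
  proof (rule N.jensens_inequality[where I = UNIV and q = exp])
    show "integrable ?N f'" using intf unfolding f'_def by simp
    show "integrable ?N (\<lambda>x. exp (f' x))"
      using integrable_exp_lipschitz_normal[OF \<sigma> f'L] by (subst integrable_density) auto
    show "convex_on UNIV (exp :: real \<Rightarrow> real)" by (rule exp_convex)
  qed auto
  moreover have "(\<integral>x. exp (f' x) \<partial>?N) = (\<integral>x. V x \<partial>lborel)"
    by (subst integral_density) (auto simp: V_def[abs_def])
  moreover have "(\<integral>x. f' x \<partial>?N) = - (s / c) * (\<integral>x. f x \<partial>?N)" by (simp add: f'_def)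
  ultimately have "exp (- (s / c) * (\<integral>x. f x \<partial>?N)) powr c \<le> (\<integral>x. V x \<partial>lborel) powr c"
    using c by (intro powr_mono2) auto
  then have Vc: "exp (- s * (\<integral>x. f x \<partial>?N)) \<le> (\<integral>x. V x \<partial>lborel) powr c"
    using c by (simp add: powr_def)
  have U0: "0 \<le> (\<integral>x. U x \<partial>lborel)" by (intro Bochner_Integration.integral_nonneg) (simp add: U_def)
  have "(\<integral>x. U x \<partial>lborel) powr s * exp (- s * (\<integral>x. f x \<partial>?N)) \<le> 1"
    using PL mult_left_mono[OF Vc, of "(\<integral>x. U x \<partial>lborel) powr s"] \<sigma> by simp
  \<comment> \<open>The exponential of the mean of \<open>f\<close> now also carries the power
    \<open>s\<close>, which monotonicity of powers removes.\<close>
  then have "(\<integral>x. U x \<partial>lborel) powr s \<le> exp (\<integral>x. f x \<partial>?N) powr s"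
    by (simp add: exp_minus powr_def divide_simps)
  then have "(\<integral>x. U x \<partial>lborel) \<le> exp (\<integral>x. f x \<partial>?N)"
    using s U0 powr_less_mono2[of s "exp (\<integral>x. f x \<partial>?N)" "\<integral>x. U x \<partial>lborel"] by fastforce
  moreover have "(\<integral>\<^sup>+x. ennreal (exp (h x)) \<partial>?N) = (\<integral>\<^sup>+x. ennreal (U x) \<partial>lborel)"
    by (subst nn_integral_density) (auto simp: U_def ennreal_mult')
  moreover have "\<dots> = ennreal (\<integral>x. U x \<partial>lborel)"
    using integrable_exp_lipschitz_normal[OF \<sigma> hL]
    by (intro nn_integral_eq_integral) (auto simp: U_def[abs_def])
  ultimately show "(\<integral>\<^sup>+x. ennreal (exp (h x)) \<partial>?N) \<le> ennreal (exp (\<integral>x. f x \<partial>?N))"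
    by (simp add: ennreal_leI)
qed

section \<open>Tensorization over finite products\<close>

lemma integrable_of_lipschitz_PiM:
  fixes f :: "('i \<Rightarrow> real) \<Rightarrow> real"
  assumes N: "prob_space N" "sets N = sets borel" "integrable N (\<lambda>x. x)"
    and I: "finite I"
    and f: "f \<in> borel_measurable (\<Pi>\<^sub>M i\<in>I. N)"
    and L: "\<And>x y. \<bar>f x - f y\<bar> \<le> L * (\<Sum>i\<in>I. \<bar>x i - y i\<bar>)"
  shows "integrable (\<Pi>\<^sub>M i\<in>I. N) f"
proof (rule Bochner_Integration.integrable_bound)
  interpret P: prob_space "\<Pi>\<^sub>M i\<in>I. N" by (intro prob_space_PiM N)
  have "integrable (\<Pi>\<^sub>M i\<in>I. N) (\<lambda>x. x i)" if "i \<in> I" for i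
  proof -
    have [measurable]: "(\<lambda>x. x) \<in> borel_measurable N" using N(3) by (rule borel_measurable_integrable)
    have "integrable (distr (\<Pi>\<^sub>M i\<in>I. N) N (\<lambda>x. x i)) (\<lambda>x. x)"
      using that N by (subst distr_PiM_component) auto
    then show ?thesis
      using that by (subst (asm) integrable_distr_eq) (auto simp: N(2))
  qed
  then show "integrable (\<Pi>\<^sub>M i\<in>I. N) (\<lambda>x. \<bar>f (\<lambda>_. 0)\<bar> + L * (\<Sum>i\<in>I. \<bar>x i\<bar>))"
    by (intro Bochner_Integration.integrable_add integrable_mult_right Bochner_Integration.integrable_sum
        integrable_abs) auto
  \<comment> \<open>The zero function need not be extensional, so it may lie outside the space of
    the product; the Lipschitz bound ranges over all functions and admits it as reference
    point.\<close>
  have "\<bar>f x\<bar> \<le> \<bar>f (\<lambda>_. 0)\<bar> + L * (\<Sum>i\<in>I. \<bar>x i\<bar>)" for x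
    using L[of x "\<lambda>_. 0"] by simp
  then show "AE x in \<Pi>\<^sub>M i\<in>I. N. norm (f x) \<le> norm (\<bar>f (\<lambda>_. 0)\<bar> + L * (\<Sum>i\<in>I. \<bar>x i\<bar>))"
    by (intro AE_I2) (metis abs_ge_self order.trans real_norm_def)
qed fact

lemma transport_inequalityD:
  assumes "transport_inequality N \<kappa>"
    and "\<And>x y. \<bar>f x - f y\<bar> \<le> L * \<bar>x - y\<bar>" "\<And>x y. \<bar>h x - h y\<bar> \<le> L * \<bar>x - y\<bar>"
    and "\<And>x y. h x \<le> f y + \<kappa> * (x - y)\<^sup>2"
  shows "(\<integral>\<^sup>+x. ennreal (exp (h x)) \<partial>N) \<le> ennreal (exp (\<integral>x. f x \<partial>N))"
  using assms unfolding transport_inequality_def by blast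

text \<open>Induction on \<open>I\<close>, integrating out the new coordinate: \<open>f\<close> is
  replaced by its mean \<open>F\<close>, and \<open>h\<close> by the logarithm \<open>H\<close> of
  its exponential mean. The inequality on the line shows that \<open>H\<close> and \<open>F\<close>
  satisfy the cost hypothesis on the remaining coordinates, and both inherit the Lipschitz bound, so
  the induction hypothesis applies to them.\<close>

lemma transport_inequality_PiM:
  fixes f h :: "('i \<Rightarrow> real) \<Rightarrow> real"
  assumes N: "prob_space N" "sets N = sets borel" "integrable N (\<lambda>x. x)"
    and T: "transport_inequality N \<kappa>"
    and I: "finite I"
    and f: "f \<in> borel_measurable (\<Pi>\<^sub>M i\<in>I. N)" "\<And>x y. \<bar>f x - f y\<bar> \<le> L * (\<Sum>i\<in>I. \<bar>x i - y i\<bar>)"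
    and h: "h \<in> borel_measurable (\<Pi>\<^sub>M i\<in>I. N)" "\<And>x y. \<bar>h x - h y\<bar> \<le> L * (\<Sum>i\<in>I. \<bar>x i - y i\<bar>)"
    and hf: "\<And>x y. h x \<le> f y + \<kappa> * (\<Sum>i\<in>I. (x i - y i)\<^sup>2)"
  shows "(\<integral>\<^sup>+x. ennreal (exp (h x)) \<partial>(\<Pi>\<^sub>M i\<in>I. N)) \<le> ennreal (exp (\<integral>x. f x \<partial>(\<Pi>\<^sub>M i\<in>I. N)))"
  using I f h hf
proof (induction I arbitrary: f h rule: finite_induct)
  case empty
  then show ?case
    \<comment> \<open>The product over the empty set is the point mass at
      \<open>\<lambda>_. undefined\<close>.\<close>
    using empty(5)[of "\<lambda>_. undefined" "\<lambda>_. undefined"]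
    by (simp add: PiM_empty nn_integral_count_space_finite lebesgue_integral_count_space_finite)
next
  case (insert i I)
  note meas[measurable] = insert.prems(1,3)
  note fL = insert.prems(2) and hL = insert.prems(4) and hf = insert.prems(5)
  interpret N: prob_space N by fact
  interpret product_sigma_finite "\<lambda>_::'i. N"
    using N(1) by (simp add: product_sigma_finite_def prob_space_imp_sigma_finite)
  have sum_upd: "(\<Sum>j\<in>insert i I. g ((x(i := a)) j) ((y(i := b)) j)) = g a b + (\<Sum>j\<in>I. g (x j) (y j))"
    for x y :: "'i \<Rightarrow> real" and a b and g :: "real \<Rightarrow> real \<Rightarrow> real"
    using insert.hyps by (auto intro!: sum.cong)
  have fL': "\<bar>f (x(i := a)) - f (y(i := b))\<bar> \<le> L * (\<bar>a - b\<bar> + (\<Sum>j\<in>I. \<bar>x j - y j\<bar>))" for x y a b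
    using fL[of "x(i := a)" "y(i := b)"] unfolding sum_upd[of "\<lambda>a b. \<bar>a - b\<bar>"] .
  have hL': "\<bar>h (x(i := a)) - h (y(i := b))\<bar> \<le> L * (\<bar>a - b\<bar> + (\<Sum>j\<in>I. \<bar>x j - y j\<bar>))" for x y a b
    using hL[of "x(i := a)" "y(i := b)"] unfolding sum_upd[of "\<lambda>a b. \<bar>a - b\<bar>"] .
  have hf': "h (x(i := a)) \<le> f (y(i := b)) + \<kappa> * ((a - b)\<^sup>2 + (\<Sum>j\<in>I. (x j - y j)\<^sup>2))" for x y a b
    using hf[of "x(i := a)" "y(i := b)"] unfolding sum_upd[of "\<lambda>a b. (a - b)\<^sup>2"] .
  have fN: "integrable N (\<lambda>b. f (y(i := b)))" for y
    by (rule integrable_of_lipschitz_real[OF N, of _ L]) (use fL'[of y _ y] in simp)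
  define F where "F y = (\<integral>b. f (y(i := b)) \<partial>N)" for y
  define G where "G x = (\<integral>\<^sup>+a. ennreal (exp (h (x(i := a)))) \<partial>N)" for x
  \<comment> \<open>The logarithm is meaningful only once \<open>G_pos\<close> and
    \<open>G_fin\<close> exclude the values zero and infinity; note that \<open>enn2real\<close>
    sends infinity to 0.\<close>
  define H where "H x = ln (enn2real (G x))" for x
  have GF: "G x \<le> ennreal (exp (F y + \<kappa> * (\<Sum>j\<in>I. (x j - y j)\<^sup>2)))" for x y
  proof -
    let ?d = "\<kappa> * (\<Sum>j\<in>I. (x j - y j)\<^sup>2)"
    \<comment> \<open>For fixed \<open>x\<close> and \<open>y\<close>, the cost \<open>?d\<close> of
      the old coordinates is a constant that can be added to \<open>f\<close>, leaving an instance
      of the inequality on the line.\<close>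
    have "G x \<le> ennreal (exp (\<integral>b. f (y(i := b)) + ?d \<partial>N))"
      unfolding G_def
    proof (rule transport_inequalityD[OF T, of _ L])
      show "h (x(i := a)) \<le> f (y(i := b)) + ?d + \<kappa> * (a - b)\<^sup>2" for a b
        using hf'[of x a y b] by (simp add: algebra_simps)
    qed (use fL'[of y _ y] hL'[of x _ x] in simp_all)
    then show ?thesis using fN by (simp add: F_def N.prob_space)
  qed
  \<comment> \<open>The Lipschitz bound of \<open>H\<close> in multiplicative form, which follows
    from monotonicity of the integral.\<close>
  have G_shift: "G x \<le> ennreal (exp (L * (\<Sum>j\<in>I. \<bar>x j - y j\<bar>))) * G y" for x y
  proof -
    have meas_h: "(\<lambda>a. h (z(i := a))) \<in> borel_measurable N" for z
      by (rule borel_measurable_integrable, rule integrable_of_lipschitz_real[OF N, of _ L])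
        (use hL'[of z _ z] in simp)
    have "G x \<le> (\<integral>\<^sup>+a. ennreal (exp (L * (\<Sum>j\<in>I. \<bar>x j - y j\<bar>))) * ennreal (exp (h (y(i := a)))) \<partial>N)"
      unfolding G_def using hL'[of x _ y]
      by (intro nn_integral_mono)
        (auto simp: ennreal_mult'[symmetric] exp_add[symmetric] intro!: ennreal_leI,
          smt (verit))
    also have "\<dots> = ennreal (exp (L * (\<Sum>j\<in>I. \<bar>x j - y j\<bar>))) * G y"
      unfolding G_def using meas_h[of y] by (subst nn_integral_cmult) auto
    finally show ?thesis .
  qed
  have G_pos: "G x \<noteq> 0" for x
  proof
    assume "G x = 0"
    moreover have "(\<lambda>a. h (x(i := a))) \<in> borel_measurable N"
      by (rule borel_measurable_integrable, rule integrable_of_lipschitz_real[OF N, of _ L])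
        (use hL'[of x _ x] in simp)
    ultimately have "AE a in N. ennreal (exp (h (x(i := a)))) = 0"
      unfolding G_def by (subst (asm) nn_integral_0_iff_AE) auto
    then have "AE a in N. False" by simp
    then show False by simp
  qed
  have G_fin: "G x < \<top>" for x
    by (rule le_less_trans[OF GF[of x x]]) simp
  have G_exp: "G x = ennreal (exp (H x))" for x
    using G_pos[of x] G_fin[of x] by (simp add: H_def enn2real_positive_iff zero_less_iff_neq_zero)
  have HL: "H x - H y \<le> L * (\<Sum>j\<in>I. \<bar>x j - y j\<bar>)" for x y
  proof -
    have "ennreal (exp (H x)) \<le> ennreal (exp (L * (\<Sum>j\<in>I. \<bar>x j - y j\<bar>) + H y))"
      using G_shift[of x y] by (simp add: G_exp exp_add ennreal_mult')
    then show ?thesis by (simp add: algebra_simps)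
  qed
  have HF: "H x \<le> F y + \<kappa> * (\<Sum>j\<in>I. (x j - y j)\<^sup>2)" for x y
    using GF[of x y] by (simp add: G_exp)
  have FL: "\<bar>F x - F y\<bar> \<le> L * (\<Sum>j\<in>I. \<bar>x j - y j\<bar>)" for x y
  proof -
    have "F x - F y = (\<integral>b. f (x(i := b)) - f (y(i := b)) \<partial>N)" using fN by (simp add: F_def)
    also have "\<bar>\<dots>\<bar> \<le> (\<integral>b. \<bar>f (x(i := b)) - f (y(i := b))\<bar> \<partial>N)" by (rule integral_abs_bound)
    also have "\<dots> \<le> (\<integral>b. L * (\<Sum>j\<in>I. \<bar>x j - y j\<bar>) \<partial>N)"
    proof (rule integral_mono)
      show "\<bar>f (x(i := b)) - f (y(i := b))\<bar> \<le> L * (\<Sum>j\<in>I. \<bar>x j - y j\<bar>)" for b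
        using fL'[of x b y b] by simp
    qed (use fN in auto)
    finally show ?thesis by (simp add: N.prob_space)
  qed
  have upd[measurable]: "(\<lambda>(x, a). x(i := a)) \<in> (\<Pi>\<^sub>M i\<in>I. N) \<Otimes>\<^sub>M N \<rightarrow>\<^sub>M (\<Pi>\<^sub>M i\<in>insert i I. N)"
    using measurable_add_dim[of i I "\<lambda>_. N"] .
  have fm: "(\<lambda>(x, a). f (x(i := a))) \<in> borel_measurable ((\<Pi>\<^sub>M i\<in>I. N) \<Otimes>\<^sub>M N)"
    using measurable_compose[OF upd meas(1)] by (simp add: case_prod_beta')
  have hm: "(\<lambda>(x, a). h (x(i := a))) \<in> borel_measurable ((\<Pi>\<^sub>M i\<in>I. N) \<Otimes>\<^sub>M N)"
    using measurable_compose[OF upd meas(2)] by (simp add: case_prod_beta')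
  have F_meas: "F \<in> borel_measurable (\<Pi>\<^sub>M i\<in>I. N)"
    unfolding F_def using N.borel_measurable_lebesgue_integral[OF fm] .
  have "G \<in> borel_measurable (\<Pi>\<^sub>M i\<in>I. N)"
    unfolding G_def using hm by (intro N.borel_measurable_nn_integral) (simp add: case_prod_beta')
  then have H_meas: "H \<in> borel_measurable (\<Pi>\<^sub>M i\<in>I. N)"
    unfolding H_def by simp
  have "(\<integral>\<^sup>+x. ennreal (exp (H x)) \<partial>(\<Pi>\<^sub>M i\<in>I. N)) \<le> ennreal (exp (\<integral>x. F x \<partial>(\<Pi>\<^sub>M i\<in>I. N)))"
  proof (rule insert.IH[OF F_meas FL H_meas _ HF])
    show "\<bar>H x - H y\<bar> \<le> L * (\<Sum>j\<in>I. \<bar>x j - y j\<bar>)" for x y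
      using HL[of x y] HL[of y x] by (simp add: abs_le_iff abs_minus_commute)
  qed
  moreover have "(\<integral>\<^sup>+x. ennreal (exp (h x)) \<partial>(\<Pi>\<^sub>M i\<in>insert i I. N)) = (\<integral>\<^sup>+x. ennreal (exp (H x)) \<partial>(\<Pi>\<^sub>M i\<in>I. N))"
    unfolding G_exp[symmetric] G_def by (rule product_nn_integral_insert[OF insert.hyps]) simp
  moreover have "(\<integral>x. f x \<partial>(\<Pi>\<^sub>M i\<in>insert i I. N)) = (\<integral>x. F x \<partial>(\<Pi>\<^sub>M i\<in>I. N))"
    unfolding F_def
    by (rule product_integral_insert[OF insert.hyps], rule integrable_of_lipschitz_PiM[OF N _ meas(1) fL])
      (use insert.hyps in simp)
  ultimately show ?case by simp
qed

section \<open>Gaussian concentration\<close>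

text \<open>It suffices to compare boxes, where density and indicator both factor over the
  coordinates.\<close>

lemma PiM_density:
  fixes p :: "'b \<Rightarrow> real"
  assumes I: "finite I" and p[measurable]: "p \<in> borel_measurable M" and p0: "\<And>x. 0 \<le> p x"
    and M: "sigma_finite_measure M" and D: "sigma_finite_measure (density M p)"
  shows "(\<Pi>\<^sub>M i\<in>I. density M p) = density (\<Pi>\<^sub>M i\<in>I. M) (\<lambda>x. \<Prod>i\<in>I. p (x i))"
proof -
  interpret M: product_sigma_finite "\<lambda>_. M" using M by (simp add: product_sigma_finite_def)
  interpret D: product_sigma_finite "\<lambda>_. density M p" using D by (simp add: product_sigma_finite_def)
  have "density (\<Pi>\<^sub>M i\<in>I. M) (\<lambda>x. \<Prod>i\<in>I. p (x i)) = (\<Pi>\<^sub>M i\<in>I. density M p)"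
  proof (rule D.PiM_eqI[OF I])
    show "sets (density (\<Pi>\<^sub>M i\<in>I. M) (\<lambda>x. \<Prod>i\<in>I. p (x i))) = sets (\<Pi>\<^sub>M i\<in>I. density M p)"
      by (simp cong: sets_PiM_cong)
    fix A :: "_ \<Rightarrow> 'b set" assume A: "\<And>i. i \<in> I \<Longrightarrow> A i \<in> sets (density M p)"
    then have A': "\<And>i. i \<in> I \<Longrightarrow> A i \<in> sets M" by simp
    have [measurable]: "Pi\<^sub>E I A \<in> sets (\<Pi>\<^sub>M i\<in>I. M)" using A' I by (intro sets_PiM_I_finite) auto
    have "emeasure (density (\<Pi>\<^sub>M i\<in>I. M) (\<lambda>x. \<Prod>i\<in>I. p (x i))) (Pi\<^sub>E I A) =
        (\<integral>\<^sup>+x. ennreal (\<Prod>i\<in>I. p (x i)) * indicator (Pi\<^sub>E I A) x \<partial>(\<Pi>\<^sub>M i\<in>I. M))"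
      by (rule emeasure_density) auto
    also have "\<dots> = (\<integral>\<^sup>+x. (\<Prod>i\<in>I. ennreal (p (x i)) * indicator (A i) (x i)) \<partial>(\<Pi>\<^sub>M i\<in>I. M))"
    proof (rule nn_integral_cong)
      fix x assume "x \<in> space (\<Pi>\<^sub>M i\<in>I. M)"
      then have "indicator (Pi\<^sub>E I A) x = (\<Prod>i\<in>I. indicator (A i) (x i) :: ennreal)"
        using I by (auto simp: space_PiM PiE_iff indicator_def prod_zero_iff)
      then show "ennreal (\<Prod>i\<in>I. p (x i)) * indicator (Pi\<^sub>E I A) x =
          (\<Prod>i\<in>I. ennreal (p (x i)) * indicator (A i) (x i))"
        by (simp add: prod.distrib prod_ennreal p0)
    qed
    also have "\<dots> = (\<Prod>i\<in>I. \<integral>\<^sup>+x. ennreal (p x) * indicator (A i) x \<partial>M)"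
      using A' by (intro M.product_nn_integral_prod I) auto
    also have "\<dots> = (\<Prod>i\<in>I. emeasure (density M p) (A i))"
      using A' by (intro prod.cong) (auto simp: emeasure_density)
    finally show "emeasure (density (\<Pi>\<^sub>M i\<in>I. M) (\<lambda>x. \<Prod>i\<in>I. p (x i))) (Pi\<^sub>E I A) =
        (\<Prod>i\<in>I. emeasure (density M p) (A i))" .
  qed
  then show ?thesis by simp
qed

lemma power2_norm_sum_Basis:
  fixes x :: "'a::euclidean_space \<Rightarrow> real"
  shows "(norm (\<Sum>b\<in>Basis. x b *\<^sub>R b))\<^sup>2 = (\<Sum>b\<in>Basis. (x b)\<^sup>2)"
  by (subst power2_norm_eq_inner, subst euclidean_inner) (simp add: power2_eq_square)

text \<open>The density factors because the squared norm is the sum of the squared coordinates, and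
  \<open>lborel\<close> is itself the image of the product of the line measures under the same map.
  This carries the results for products over to the law of the noise.\<close>

lemma density_isotropic_normal_eq:
  assumes \<sigma>: "0 < \<sigma>"
  shows "density lborel (\<lambda>x :: real ^ 'n. ennreal (isotropic_normal_density 0 \<sigma> x)) =
    distr (\<Pi>\<^sub>M b\<in>Basis. density lborel (normal_density 0 \<sigma>)) borel (\<lambda>x. \<Sum>b\<in>Basis. x b *\<^sub>R b)"
proof -
  let ?S = "\<lambda>x. (\<Sum>b\<in>Basis. x b *\<^sub>R b) :: real ^ 'n"
  have [measurable]: "?S \<in> borel_measurable (\<Pi>\<^sub>M b\<in>Basis. lborel)" by measurable
  have [measurable]: "isotropic_normal_density 0 \<sigma> \<in> borel_measurable (borel :: (real ^ 'n) measure)"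
    unfolding isotropic_normal_density_def[abs_def] by measurable
  have iso: "isotropic_normal_density 0 \<sigma> (?S x) = (\<Prod>b\<in>Basis. normal_density 0 \<sigma> (x b))" for x
  proof -
    have "(\<Prod>b\<in>(Basis :: (real ^ 'n) set). normal_density 0 \<sigma> (x b)) =
      (1 / sqrt (2 * pi * \<sigma>\<^sup>2)) ^ CARD('n) * exp (\<Sum>b\<in>(Basis :: (real ^ 'n) set). - (x b)\<^sup>2 / (2 * \<sigma>\<^sup>2))"
      unfolding normal_density_def by (simp only: prod.distrib prod_constant exp_sum[OF finite_Basis] DIM_cart) simp
    also have "(\<Sum>b\<in>(Basis :: (real ^ 'n) set). - (x b)\<^sup>2 / (2 * \<sigma>\<^sup>2)) = - (norm (?S x))\<^sup>2 / (2 * \<sigma>\<^sup>2)"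
      unfolding power2_norm_sum_Basis by (simp add: sum_divide_distrib sum_negf)
    finally show ?thesis by (simp add: isotropic_normal_density_def power_one_over)
  qed
  have "density lborel (\<lambda>x :: real ^ 'n. ennreal (isotropic_normal_density 0 \<sigma> x)) =
      density (distr (\<Pi>\<^sub>M b\<in>Basis. lborel) borel ?S) (\<lambda>x. ennreal (isotropic_normal_density 0 \<sigma> x))"
    by (subst lborel_eq) simp
  also have "\<dots> = distr (density (\<Pi>\<^sub>M b\<in>Basis. lborel) (\<lambda>x. ennreal (isotropic_normal_density 0 \<sigma> (?S x)))) borel ?S"
    by (rule density_distr) measurable
  also have "density (\<Pi>\<^sub>M b\<in>Basis. lborel) (\<lambda>x. ennreal (isotropic_normal_density 0 \<sigma> (?S x))) =
      (\<Pi>\<^sub>M b\<in>Basis. density lborel (normal_density 0 \<sigma>))"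
    unfolding iso
    by (rule PiM_density[symmetric])
      (auto simp: sigma_finite_lborel prob_space_imp_sigma_finite prob_space_normal_density[OF \<sigma>])
  finally show ?thesis .
qed

section \<open>Moment generating function and upper tail of a Lipschitz function\<close>

context
  fixes M :: "'a measure" and \<xi> :: "'a \<Rightarrow> real ^ 'n" and \<sigma> :: real and F :: "real ^ 'n \<Rightarrow> real" and L :: real
  assumes \<sigma>: "0 < \<sigma>"
    and \<xi>: "distributed M lborel \<xi> (\<lambda>x. ennreal (isotropic_normal_density 0 \<sigma> x))"
    and F: "\<And>x y. \<bar>F x - F y\<bar> \<le> L * norm (x - y)"
begin

text \<open>The transport inequality is used with \<open>h\<close> equal to \<open>F\<close> in
  coordinates and \<open>f\<close> the same function raised by a constant. The constant is chosen so
  that a quadratic cost makes up for the linear growth permitted by the Lipschitz bound.\<close>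

lemma gaussian_lipschitz_integrable: "integrable M (\<lambda>\<omega>. F (\<xi> \<omega>))"
  and gaussian_lipschitz_mgf:
    "(\<integral>\<^sup>+\<omega>. ennreal (exp (F (\<xi> \<omega>))) \<partial>M) \<le> ennreal (exp ((\<integral>\<omega>. F (\<xi> \<omega>) \<partial>M) + L\<^sup>2 * \<sigma>\<^sup>2 / 2))"
proof -
  let ?N = "density lborel (normal_density 0 \<sigma>)"
  let ?P = "\<Pi>\<^sub>M b\<in>(Basis :: (real ^ 'n) set). ?N"
  define S where "S x = (\<Sum>b\<in>Basis. x b *\<^sub>R b)" for x :: "real ^ 'n \<Rightarrow> real"
  have N: "prob_space ?N" "sets ?N = sets borel" "integrable ?N (\<lambda>x. x)"
    using prob_space_normal_density[OF \<sigma>] integrable_ident_normal[OF \<sigma>] by auto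
  interpret P: prob_space ?P by (intro prob_space_PiM N)
  have S_meas[measurable]: "S \<in> borel_measurable ?P" unfolding S_def by measurable
  have "continuous_on UNIV F"
    by (rule continuous_on_of_lipschitz_real[of _ L]) (use F in \<open>auto simp: dist_norm\<close>)
  then have F_meas[measurable]: "F \<in> borel_measurable borel" by (rule borel_measurable_continuous_onI)
  have \<xi>_meas[measurable]: "\<xi> \<in> borel_measurable M" using distributed_measurable[OF \<xi>] by simp
  have \<xi>_distr: "distr M borel \<xi> = distr ?P borel S"
    using distributed_distr_eq_density[OF \<xi>] density_isotropic_normal_eq[OF \<sigma>, where 'n = 'n]
    by (simp add: S_def[abs_def] cong: distr_cong)
  have S_diff: "S x - S y = S (\<lambda>b. x b - y b)" for x y
    by (simp add: S_def scaleR_diff_left sum_subtractf)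
  have norm_S: "norm (S x) \<le> (\<Sum>b\<in>Basis. \<bar>x b\<bar>)" for x
    unfolding S_def by (rule order.trans[OF norm_sum]) simp
  \<comment> \<open>The transport inequality asks for a Lipschitz bound in the sum norm, whose
    constant does not enter its conclusion. The sharp constant comes from the Euclidean bound on
    \<open>F\<close>, used below against the quadratic cost.\<close>
  have FS_L: "\<bar>F (S x) - F (S y)\<bar> \<le> \<bar>L\<bar> * (\<Sum>b\<in>Basis. \<bar>x b - y b\<bar>)" for x y
    using F[of "S x" "S y"] mult_mono[OF abs_ge_self[of L] norm_S[of "\<lambda>b. x b - y b"]]
    unfolding S_diff by (smt (verit) abs_ge_zero norm_ge_zero)
  have FS_int: "integrable ?P (\<lambda>x. F (S x))"
    by (rule integrable_of_lipschitz_PiM[OF N _ _ FS_L]) auto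
  then have "integrable (distr M borel \<xi>) F"
    unfolding \<xi>_distr by (subst integrable_distr_eq) auto
  then show "integrable M (\<lambda>\<omega>. F (\<xi> \<omega>))" by (subst (asm) integrable_distr_eq) auto
  have E_eq: "(\<integral>x. F (S x) \<partial>?P) = (\<integral>\<omega>. F (\<xi> \<omega>) \<partial>M)"
    using integral_distr[of \<xi> M borel F] integral_distr[of S ?P borel F] \<xi>_distr by simp
  have X_eq: "(\<integral>\<^sup>+x. ennreal (exp (F (S x))) \<partial>?P) = (\<integral>\<^sup>+\<omega>. ennreal (exp (F (\<xi> \<omega>))) \<partial>M)"
    using nn_integral_distr[of \<xi> M borel "\<lambda>z. ennreal (exp (F z))"]
      nn_integral_distr[of S ?P borel "\<lambda>z. ennreal (exp (F z))"] \<xi>_distr by simp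
  let ?E = "\<integral>\<omega>. F (\<xi> \<omega>) \<partial>M" and ?X = "\<integral>\<^sup>+\<omega>. ennreal (exp (F (\<xi> \<omega>))) \<partial>M"
  have bound: "?X \<le> ennreal (exp (?E + L\<^sup>2 * \<sigma>\<^sup>2 / (2 * c)))" if c: "0 < c" "c < 1" for c
  proof -
    \<comment> \<open>For nonnegative \<open>L\<close>, this is the maximum of
      \<open>L * r - c / (2 * \<sigma>\<^sup>2) * r\<^sup>2\<close> over real \<open>r\<close>; the
      completed square below gives the upper bound for either sign of \<open>L\<close>.\<close>
    let ?d = "L\<^sup>2 * \<sigma>\<^sup>2 / (2 * c)"
    have "(\<integral>\<^sup>+x. ennreal (exp (F (S x))) \<partial>?P) \<le> ennreal (exp (\<integral>x. F (S x) + ?d \<partial>?P))"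
    proof (rule transport_inequality_PiM[OF N transport_inequality_normal[OF \<sigma> c], of _ _ "\<bar>L\<bar>"])
      fix x y :: "real ^ 'n \<Rightarrow> real"
      let ?n = "norm (S x - S y)"
      have "0 \<le> (sqrt c / \<sigma> * ?n - L * \<sigma> / sqrt c)\<^sup>2" by simp
      also have "\<dots> = c / \<sigma>\<^sup>2 * ?n\<^sup>2 - 2 * L * ?n + L\<^sup>2 * \<sigma>\<^sup>2 / c"
        using c \<sigma> by (simp add: power2_diff power_mult_distrib power_divide)
      also have "\<dots> = 2 * (c / (2 * \<sigma>\<^sup>2) * ?n\<^sup>2 - L * ?n + ?d)"
        by (simp add: ring_distribs)
      finally have "L * ?n \<le> c / (2 * \<sigma>\<^sup>2) * ?n\<^sup>2 + ?d"
        unfolding zero_le_mult_iff by linarith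
      moreover have "?n\<^sup>2 = (\<Sum>b\<in>Basis. (x b - y b)\<^sup>2)"
        unfolding S_diff unfolding S_def by (rule power2_norm_sum_Basis)
      ultimately show "F (S x) \<le> F (S y) + ?d + c / (2 * \<sigma>\<^sup>2) * (\<Sum>b\<in>Basis. (x b - y b)\<^sup>2)"
        using F[of "S x" "S y"] by (auto simp del: S_diff)
    qed (use FS_L in auto)
    moreover have "(\<integral>x. F (S x) + ?d \<partial>?P) = ?E + ?d"
      using FS_int E_eq by (simp add: P.prob_space)
    ultimately show ?thesis unfolding X_eq by simp
  qed
  \<comment> \<open>The estimate is available only for \<open>c < 1\<close>; being non-strict, it
    survives the limit from the left.\<close>
  have "((\<lambda>c. exp (?E + L\<^sup>2 * \<sigma>\<^sup>2 / (2 * c))) \<longlongrightarrow> exp (?E + L\<^sup>2 * \<sigma>\<^sup>2 / (2 * 1))) (at_left 1)"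
    by (intro tendsto_intros) auto
  then have "((\<lambda>c. ennreal (exp (?E + L\<^sup>2 * \<sigma>\<^sup>2 / (2 * c)))) \<longlongrightarrow> ennreal (exp (?E + L\<^sup>2 * \<sigma>\<^sup>2 / (2 * 1)))) (at_left 1)"
    by (rule tendsto_ennrealI)
  then have "?X \<le> ennreal (exp (?E + L\<^sup>2 * \<sigma>\<^sup>2 / (2 * 1)))"
  proof (rule tendsto_lowerbound)
    have "\<forall>\<^sub>F c in at_left (1::real). c \<in> {0<..<1}"
      by (rule eventually_at_left_real) simp
    then show "\<forall>\<^sub>F c in at_left 1. ?X \<le> ennreal (exp (?E + L\<^sup>2 * \<sigma>\<^sup>2 / (2 * c)))"
      by eventually_elim (use bound in auto)
  qed simp
  then show "?X \<le> ennreal (exp (?E + L\<^sup>2 * \<sigma>\<^sup>2 / 2))" by simp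
qed

end

text \<open>Chernoff's method: Markov's inequality for the exponential of \<open>l * F\<close>,
  which is Lipschitz with constant \<open>l * L\<close>.\<close>

lemma gaussian_concentration:
  fixes \<xi> :: "'a \<Rightarrow> real ^ 'n" and F :: "real ^ 'n \<Rightarrow> real"
  assumes M: "prob_space M" and \<sigma>: "0 < \<sigma>" and L: "0 < L"
    and \<xi>: "distributed M lborel \<xi> (\<lambda>x. ennreal (isotropic_normal_density 0 \<sigma> x))"
    and F: "\<And>x y. \<bar>F x - F y\<bar> \<le> L * norm (x - y)"
    and r: "0 \<le> r"
  shows "measure M {\<omega> \<in> space M. (\<integral>\<omega>. F (\<xi> \<omega>) \<partial>M) + r \<le> F (\<xi> \<omega>)} \<le> exp (- (r\<^sup>2 / (2 * L\<^sup>2 * \<sigma>\<^sup>2)))"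
proof -
  interpret prob_space M by fact
  let ?E = "\<integral>\<omega>. F (\<xi> \<omega>) \<partial>M"
  \<comment> \<open>This value minimizes the exponent
    \<open>(l * L)\<^sup>2 * \<sigma>\<^sup>2 / 2 - l * r\<close>.\<close>
  define l where "l = r / (L\<^sup>2 * \<sigma>\<^sup>2)"
  have l: "0 \<le> l" using r by (simp add: l_def)
  have lF: "\<bar>l * F x - l * F y\<bar> \<le> (l * L) * norm (x - y)" for x y
    using mult_left_mono[OF F[of x y] l] l by (simp add: right_diff_distrib[symmetric] abs_mult mult.assoc)
  have [measurable]: "(\<lambda>\<omega>. F (\<xi> \<omega>)) \<in> borel_measurable M"
    using gaussian_lipschitz_integrable[OF \<sigma> \<xi> F] by auto
  have "emeasure M {\<omega> \<in> space M. ?E + r \<le> F (\<xi> \<omega>)} \<le>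
      emeasure M ({\<omega> \<in> space M. 1 \<le> ennreal (exp (- l * (?E + r))) * ennreal (exp (l * F (\<xi> \<omega>)))} \<inter> space M)"
  proof (rule emeasure_mono)
    have "1 \<le> ennreal (exp (- l * (?E + r))) * ennreal (exp (l * F z))" if "?E + r \<le> F z" for z
    proof -
      have "1 \<le> exp (- l * (?E + r) + l * F z)"
        using mult_left_mono[OF that l] by simp
      then show ?thesis
        by (simp only: ennreal_mult'[symmetric] exp_ge_zero exp_add[symmetric] ennreal_1[symmetric] ennreal_leI)
    qed
    then show "{\<omega> \<in> space M. ?E + r \<le> F (\<xi> \<omega>)} \<subseteq>
      {\<omega> \<in> space M. 1 \<le> ennreal (exp (- l * (?E + r))) * ennreal (exp (l * F (\<xi> \<omega>)))} \<inter> space M"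
      by blast
  qed measurable
  also have "\<dots> \<le> ennreal (exp (- l * (?E + r))) * (\<integral>\<^sup>+\<omega>. ennreal (exp (l * F (\<xi> \<omega>))) * indicator (space M) \<omega> \<partial>M)"
    by (rule order.trans[OF _ nn_integral_Markov_inequality]) (auto intro!: emeasure_mono)
  also have "(\<integral>\<^sup>+\<omega>. ennreal (exp (l * F (\<xi> \<omega>))) * indicator (space M) \<omega> \<partial>M) = (\<integral>\<^sup>+\<omega>. ennreal (exp (l * F (\<xi> \<omega>))) \<partial>M)"
    by (intro nn_integral_cong) auto
  also have "\<dots> \<le> ennreal (exp (l * ?E + (l * L)\<^sup>2 * \<sigma>\<^sup>2 / 2))"
    using gaussian_lipschitz_mgf[OF \<sigma> \<xi> lF] by simp
  also have "ennreal (exp (- l * (?E + r))) * \<dots> = ennreal (exp (- (r\<^sup>2 / (2 * L\<^sup>2 * \<sigma>\<^sup>2))))"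
  proof -
    have "- l * (?E + r) + (l * ?E + (l * L)\<^sup>2 * \<sigma>\<^sup>2 / 2) = (l * L)\<^sup>2 * \<sigma>\<^sup>2 / 2 - l * r"
      by (simp add: algebra_simps)
    also have "\<dots> = - (r\<^sup>2 / (2 * L\<^sup>2 * \<sigma>\<^sup>2))"
      using L \<sigma> by (simp add: l_def power2_eq_square divide_simps)
    finally show ?thesis by (simp add: ennreal_mult'[symmetric] exp_add[symmetric])
  qed
  finally show ?thesis by (simp add: emeasure_eq_measure mult_left_mono)
qed

section \<open>Projections and the least squares estimator\<close>

text \<open>The criterion orders the points of \<open>K\<close> as their distance to
  \<open>y\<close> does. Uniqueness of the closest point then settles the choice made by
  \<open>ARG_MIN\<close>.\<close>

lemma lse_eq_closest_point:
  fixes K :: "(real ^ 'n) set"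
  assumes "closed K" "convex K" "K \<noteq> {}"
  shows "lse K y = closest_point K y"
  unfolding lse_def
proof (rule arg_minI)
  have mono: "(scaled_norm (y - v))\<^sup>2 < (scaled_norm (y - w))\<^sup>2 \<longleftrightarrow> dist y v < dist y w" for v w
    by (auto simp: scaled_norm_def dist_norm divide_less_cancel
        intro: power_strict_mono power_less_imp_less_base)
  show "closest_point K y \<in> K" using assms by (intro closest_point_in_set)
  show "\<not> (scaled_norm (y - v))\<^sup>2 < (scaled_norm (y - closest_point K y))\<^sup>2" if "v \<in> K" for v
    using closest_point_le[OF assms(1) that, of y] by (simp add: mono)
  show "v = closest_point K y"
    if "v \<in> K" "\<forall>w. w \<in> K \<longrightarrow> \<not> (scaled_norm (y - w))\<^sup>2 < (scaled_norm (y - v))\<^sup>2" for v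
    using that by (intro closest_point_unique assms) (auto simp: mono not_less)
qed

text \<open>Firm nonexpansiveness of the projection: test the variational inequality of each
  projected point with the other one and add; \<mu> cancels.\<close>

lemma closest_point_perturbation:
  fixes K :: "'a::euclidean_space set" and \<mu> :: 'a
  assumes "closed K" "convex K" "K \<noteq> {}"
  defines "d \<equiv> \<lambda>x. closest_point K (\<mu> + x) - closest_point K \<mu>"
  shows "(norm (d x))\<^sup>2 \<le> x \<bullet> d x"
proof -
  define p q where "p = closest_point K (\<mu> + x)" and "q = closest_point K \<mu>"
  define e where "e = p - q"
  have "(\<mu> + x - p) \<bullet> (q - p) \<le> 0" "(\<mu> - q) \<bullet> (p - q) \<le> 0"
    using assms by (auto simp: p_def q_def intro!: closest_point_dot closest_point_in_set)
  then have "(\<mu> + x - p) \<bullet> - e \<le> 0" "(\<mu> - q) \<bullet> e \<le> 0" by (simp_all add: e_def)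
  moreover have "(norm e)\<^sup>2 = (p - q) \<bullet> e" unfolding power2_norm_eq_inner by (simp add: e_def)
  ultimately have "(norm e)\<^sup>2 \<le> x \<bullet> e" by (simp add: inner_diff_left inner_add_left)
  then show ?thesis by (simp add: d_def e_def p_def q_def)
qed

text \<open>This form gives access to the facts on hulls and closures that make the tangent cone of
  a convex set a closed convex cone.\<close>

lemma tangent_cone_eq_closure_cone_hull:
  "tangent_cone K u = closure (cone hull ((\<lambda>v. v - u) ` K))"
  unfolding tangent_cone_def cone_hull_expl by (rule arg_cong[where f = closure]) blast

text \<open>The residual of the projection lies in the polar cone: a convex cone is closed under
  addition, so \<open>closest_point T x + w\<close> is a legitimate test point in the variational
  inequality.\<close>

lemma inner_le_inner_closest_point_convex_cone:
  fixes T :: "'a::euclidean_space set"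
  assumes "closed T" "convex T" "cone T" "w \<in> T"
  shows "x \<bullet> w \<le> closest_point T x \<bullet> w"
proof -
  have "closest_point T x \<in> T" using assms by (intro closest_point_in_set) auto
  then have "closest_point T x + w \<in> T" using assms convex_cone[of T] by auto
  then have "(x - closest_point T x) \<bullet> (closest_point T x + w - closest_point T x) \<le> 0"
    using assms by (intro closest_point_dot)
  then show ?thesis by (simp add: inner_diff_left)
qed

lemma norm_closest_point_perturbation_le_tangent_cone:
  fixes K :: "(real ^ 'n) set" and \<mu> :: "real ^ 'n"
  assumes K: "closed K" "convex K" "K \<noteq> {}" and \<sigma>: "0 < \<sigma>"
  defines "u \<equiv> closest_point K \<mu>"
  shows "norm (closest_point K (\<mu> + \<sigma> *\<^sub>R x) - u) \<le> \<sigma> * norm (closest_point (tangent_cone K u) x)"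
proof -
  define w where "w = closest_point K (\<mu> + \<sigma> *\<^sub>R x) - u"
  define p where "p = closest_point (tangent_cone K u) x"
  have "w \<in> cone hull ((\<lambda>v. v - u) ` K)"
    unfolding w_def using K by (intro hull_inc imageI closest_point_in_set)
  then have "w \<in> tangent_cone K u"
    unfolding tangent_cone_eq_closure_cone_hull using closure_subset by blast
  moreover have "convex ((\<lambda>v. v - u) ` K)" using K(2) by (simp add: convex_translation_subtract)
  ultimately have "x \<bullet> w \<le> p \<bullet> w"
    unfolding p_def tangent_cone_eq_closure_cone_hull
    by (intro inner_le_inner_closest_point_convex_cone)
      (auto intro!: convex_closure convex_cone_hull cone_closure cone_cone_hull)
  have "(norm w)\<^sup>2 \<le> (\<sigma> *\<^sub>R x) \<bullet> w"
    using closest_point_perturbation[OF K, of \<mu> "\<sigma> *\<^sub>R x"] by (simp add: w_def u_def)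
  also have "\<dots> \<le> \<sigma> * (p \<bullet> w)" using \<open>x \<bullet> w \<le> p \<bullet> w\<close> \<sigma> by simp
  also have "\<dots> \<le> \<sigma> * (norm p * norm w)" using \<sigma> by (simp add: norm_cauchy_schwarz)
  \<comment> \<open>The estimate is quadratic in \<open>w\<close>; cancelling one factor
    \<open>norm w\<close> leaves the claim.\<close>
  finally have "norm w * norm w \<le> (\<sigma> * norm p) * norm w" by (simp add: power2_eq_square mult.assoc)
  then have "norm w \<le> \<sigma> * norm p"
    using \<sigma> by (cases "w = 0") auto
  then show ?thesis by (simp add: w_def p_def)
qed

text \<open>By Cauchy-Schwarz each functional is Lipschitz with constant \<open>t\<close>, and a
  pointwise supremum keeps the constant. Nonemptiness and the norm bound make the real-valued
  \<open>SUP\<close> a genuine supremum.\<close>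

lemma
  fixes B :: "'a::real_inner set"
  assumes B: "B \<noteq> {}" "\<And>v. v \<in> B \<Longrightarrow> norm v \<le> t"
  shows bdd_above_inner_bounded: "bdd_above ((\<lambda>v. x \<bullet> v) ` B)"
    and lipschitz_SUP_inner: "\<bar>(SUP v\<in>B. x \<bullet> v) - (SUP v\<in>B. y \<bullet> v)\<bar> \<le> t * norm (x - y)"
proof -
  have le: "x \<bullet> v \<le> t * norm x" if "v \<in> B" for x v
    using norm_cauchy_schwarz[of x v] mult_left_mono[OF B(2)[OF that], of "norm x"]
    by (simp add: mult.commute)
  have bdd: "bdd_above ((\<lambda>v. x \<bullet> v) ` B)" for x using le by (auto intro!: bdd_aboveI[of _ "t * norm x"])
  then show "bdd_above ((\<lambda>v. x \<bullet> v) ` B)" .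
  have "(SUP v\<in>B. x \<bullet> v) \<le> (SUP v\<in>B. y \<bullet> v) + t * norm (x - y)" for x y
  proof (rule cSUP_least[OF B(1)])
    fix v assume v: "v \<in> B"
    have "y \<bullet> v \<le> (SUP v\<in>B. y \<bullet> v)" using v bdd by (intro cSUP_upper)
    then show "x \<bullet> v \<le> (SUP v\<in>B. y \<bullet> v) + t * norm (x - y)"
      using le[OF v, of "x - y"] by (simp add: inner_diff_left)
  qed
  from this[of x y] this[of y x] show "\<bar>(SUP v\<in>B. x \<bullet> v) - (SUP v\<in>B. y \<bullet> v)\<bar> \<le> t * norm (x - y)"
    by (simp add: norm_minus_commute abs_le_iff)
qed

text \<open>Shrinking \<open>closest_point K (\<mu> + x)\<close> towards \<open>u\<close> until it is at distance \<open>t\<close> keeps it in \<open>K\<close>.\<close>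

lemma closest_point_perturbation_le_SUP:
  fixes K :: "'a::euclidean_space set" and \<mu> :: 'a
  assumes K: "closed K" "convex K" "K \<noteq> {}" and t: "0 < t"
  defines "u \<equiv> closest_point K \<mu>"
  assumes far: "t < norm (closest_point K (\<mu> + x) - u)"
  shows "t * norm (closest_point K (\<mu> + x) - u) \<le> (SUP v\<in>{v \<in> K. norm (v - u) \<le> t}. x \<bullet> (v - u))"
proof -
  define w where "w = closest_point K (\<mu> + x) - u"
  have w: "t < norm w" using far by (simp add: w_def)
  have u: "u \<in> K" unfolding u_def using K by (intro closest_point_in_set)
  define a where "a = t / norm w"
  have a: "0 \<le> a" "a \<le> 1" "a * norm w = t" using w t less_trans[OF t w] by (auto simp: a_def divide_le_eq_1)
  let ?B = "{v \<in> K. norm (v - u) \<le> t}"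
  have "(1 - a) *\<^sub>R u + a *\<^sub>R closest_point K (\<mu> + x) \<in> K"
    using a u K by (intro convexD closest_point_in_set) auto
  moreover have "(1 - a) *\<^sub>R u + a *\<^sub>R closest_point K (\<mu> + x) = u + a *\<^sub>R w"
    by (simp add: w_def algebra_simps)
  ultimately have aw: "u + a *\<^sub>R w \<in> ?B"
    using a by simp
  have "(norm w)\<^sup>2 \<le> x \<bullet> w"
    using closest_point_perturbation[OF K] by (simp add: w_def u_def)
  \<comment> \<open>Since \<open>a * norm w = t\<close>, the left side is
    \<open>t * norm w\<close>.\<close>
  then have "a * (norm w)\<^sup>2 \<le> x \<bullet> (u + a *\<^sub>R w - u)"
    using a by (simp add: mult_left_mono)
  also have "\<dots> \<le> (SUP v\<in>?B. x \<bullet> (v - u))"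
  proof (rule cSUP_upper[OF aw])
    have "bdd_above ((\<lambda>v. x \<bullet> v) ` (\<lambda>v. v - u) ` ?B)"
      by (rule bdd_above_inner_bounded) (use aw in blast)+
    then show "bdd_above ((\<lambda>v. x \<bullet> (v - u)) ` ?B)" by (simp only: image_image)
  qed
  finally show ?thesis using a by (simp add: w_def[symmetric] power2_eq_square mult.assoc[symmetric])
qed

section \<open>The two bounds for the least squares estimator\<close>

theorem corollary5p2:
  fixes M :: "'a measure"
    and K :: "(real ^ 'n) set"
    and \<mu> :: "real ^ 'n"
    and \<sigma> :: real
    and \<xi> y g :: "'a \<Rightarrow> real ^ 'n"
  assumes "prob_space M"
    and "closed K" and "convex K" and "K \<noteq> {}"
    and "\<sigma> > 0"
    and "distributed M lborel \<xi> (\<lambda>x. ennreal (isotropic_normal_density 0 \<sigma> x))"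
    and "y = (\<lambda>\<omega>. \<mu> + \<xi> \<omega>)"
    and "g = (\<lambda>\<omega>. (1 / \<sigma>) *\<^sub>R \<xi> \<omega>)"
  shows
    "(AE \<omega> in M. scaled_norm (lse K (y \<omega>) - closest_point K \<mu>)
        \<le> \<sigma> / sqrt (real CARD('n)) *
            norm (closest_point (tangent_cone K (closest_point K \<mu>)) (g \<omega>)))
     \<and>
     (\<forall>t>0.
        (\<integral>\<omega>. (SUP v\<in>{v \<in> K. norm (v - closest_point K \<mu>) \<le> t}.
                  \<xi> \<omega> \<bullet> (v - closest_point K \<mu>)) \<partial>M) \<le> t\<^sup>2 / 2
        \<longrightarrow> (\<forall>x>0. measure M {\<omega> \<in> space M.
                norm (lse K (y \<omega>) - closest_point K \<mu>) \<le> t + \<sigma> * sqrt (2 * x)}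
              \<ge> 1 - exp (- x)))"
proof -
  interpret prob_space M by fact
  note K = \<open>closed K\<close> \<open>convex K\<close> \<open>K \<noteq> {}\<close>
  note \<xi> = \<open>distributed M lborel \<xi> (\<lambda>x. ennreal (isotropic_normal_density 0 \<sigma> x))\<close>
  define u where "u = closest_point K \<mu>"
  have y: "lse K (y \<omega>) = closest_point K (\<mu> + \<xi> \<omega>)" for \<omega>
    unfolding lse_eq_closest_point[OF K] \<open>y = (\<lambda>\<omega>. \<mu> + \<xi> \<omega>)\<close> ..
  have [measurable]: "\<xi> \<in> borel_measurable M" using distributed_measurable[OF \<xi>] by simp
  have "continuous_on UNIV (closest_point K)" using K by (intro continuous_on_closest_point)
  then have [measurable]: "closest_point K \<in> borel_measurable borel"
    by (rule borel_measurable_continuous_onI)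
  \<comment> \<open>This holds for every outcome, hence almost surely.\<close>
  have "scaled_norm (lse K (y \<omega>) - u)
      \<le> \<sigma> / sqrt (real CARD('n)) * norm (closest_point (tangent_cone K u) (g \<omega>))" for \<omega>
    using norm_closest_point_perturbation_le_tangent_cone[OF K \<open>0 < \<sigma>\<close>, of \<mu> "g \<omega>"] \<open>0 < \<sigma>\<close>
    by (simp add: y \<open>g = (\<lambda>\<omega>. (1 / \<sigma>) *\<^sub>R \<xi> \<omega>)\<close> u_def scaled_norm_def real_sqrt_divide divide_right_mono)
  moreover have "1 - exp (- x) \<le> measure M {\<omega> \<in> space M. norm (lse K (y \<omega>) - u) \<le> t + \<sigma> * sqrt (2 * x)}"
    if t: "0 < t" and x: "0 < x"
      and E: "(\<integral>\<omega>. (SUP v\<in>{v \<in> K. norm (v - u) \<le> t}. \<xi> \<omega> \<bullet> (v - u)) \<partial>M) \<le> t\<^sup>2 / 2" for t x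
  proof -
    define F where "F z = (SUP v\<in>{v \<in> K. norm (v - u) \<le> t}. z \<bullet> (v - u))" for z
    let ?B = "{v \<in> K. norm (v - u) \<le> t}"
    have u: "u \<in> ?B" using K t by (simp add: u_def closest_point_in_set)
    have F: "\<bar>F a - F b\<bar> \<le> t * norm (a - b)" for a b
    proof -
      \<comment> \<open>Indexing by the differences \<open>v - u\<close> turns \<open>F\<close> into
        a supremum of linear functionals with norm bound \<open>t\<close>.\<close>
      have "\<bar>(SUP v\<in>(\<lambda>v. v - u) ` ?B. a \<bullet> v) - (SUP v\<in>(\<lambda>v. v - u) ` ?B. b \<bullet> v)\<bar> \<le> t * norm (a - b)"
        by (rule lipschitz_SUP_inner) (use u in blast)+
      then show ?thesis by (simp add: F_def image_image)
    qed
    \<comment> \<open>This is \<open>t\<close> times the allowed excess over \<open>t\<close>; with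
      Lipschitz constant \<open>t\<close>, the Gaussian exponent becomes exactly
      \<open>x\<close>.\<close>
    let ?r = "t * \<sigma> * sqrt (2 * x)"
    let ?good = "{\<omega> \<in> space M. norm (lse K (y \<omega>) - u) \<le> t + \<sigma> * sqrt (2 * x)}"
    let ?bad = "{\<omega> \<in> space M. (\<integral>\<omega>. F (\<xi> \<omega>) \<partial>M) + ?r \<le> F (\<xi> \<omega>)}"
    have [measurable]: "(\<lambda>\<omega>. F (\<xi> \<omega>)) \<in> borel_measurable M"
      using gaussian_lipschitz_integrable[OF \<open>0 < \<sigma>\<close> \<xi> F] by auto
    \<comment> \<open>If the estimator is too far away, shrinking gives
      \<open>F (\<xi> \<omega>) \<ge> t\<^sup>2 + ?r\<close>. The hypothesis puts the mean of
      \<open>F\<close> below \<open>t\<^sup>2\<close>, so \<open>F\<close> exceeds its mean by at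
      least \<open>?r\<close>.\<close>
    have "space M - ?good \<subseteq> ?bad"
    proof safe
      fix \<omega> assume "\<omega> \<in> space M" and n: "\<not> norm (lse K (y \<omega>) - u) \<le> t + \<sigma> * sqrt (2 * x)"
      let ?w = "closest_point K (\<mu> + \<xi> \<omega>) - u"
      have w: "t + \<sigma> * sqrt (2 * x) < norm ?w" using n by (simp add: y)
      moreover have "0 < \<sigma> * sqrt (2 * x)" using x \<open>0 < \<sigma>\<close> by simp
      ultimately have "t < norm ?w" by linarith
      then have "t * norm ?w \<le> F (\<xi> \<omega>)"
        unfolding F_def u_def by (intro closest_point_perturbation_le_SUP K t)
      moreover have "t * (t + \<sigma> * sqrt (2 * x)) \<le> t * norm ?w" using w t by simp
      moreover have "t * (t + \<sigma> * sqrt (2 * x)) = t\<^sup>2 + ?r" by (simp add: algebra_simps power2_eq_square)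
      moreover have "(\<integral>\<omega>. F (\<xi> \<omega>) \<partial>M) \<le> t\<^sup>2 / 2" using E by (simp add: F_def)
      moreover have "0 < t\<^sup>2" using t by simp
      ultimately show "(\<integral>\<omega>. F (\<xi> \<omega>) \<partial>M) + ?r \<le> F (\<xi> \<omega>)" by linarith
    qed
    then have "prob (space M - ?good) \<le> prob ?bad" by (intro finite_measure_mono) measurable
    also have "\<dots> \<le> exp (- (?r\<^sup>2 / (2 * t\<^sup>2 * \<sigma>\<^sup>2)))"
      using t x \<open>0 < \<sigma>\<close> by (intro gaussian_concentration \<xi> F prob_space_axioms) auto
    also have "?r\<^sup>2 / (2 * t\<^sup>2 * \<sigma>\<^sup>2) = x"
      using t x \<open>0 < \<sigma>\<close> by (simp add: power_mult_distrib)
    finally show ?thesis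
      by (subst (asm) prob_compl) (simp_all add: y)
  qed
  ultimately show ?thesis unfolding u_def by blast
qed

end
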